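(* Let $a,b\in\mathbb{R}$ with $ab<0$. There exists a value $\bar\mu=\bar\mu(a,b)>0$ such that if $|\mu|>\bar\mu$, then the equation $x'=f(x)+\mu\sin t$ has only one limit cycle $u(t,0,x)$. Moreover, this limit cycle is symmetric, hyperbolic, globally asymptotically stable when $b>0$ and unstable when $b<0$, and its initial condition $x$ satisfies $|x|\le|\mu|\,(1+1/|a|)$.
   Context: For $a,b\in\mathbb{R}$, the function $f:\mathbb{R}\to\mathbb{R}$ is the continuous odd piecewise linear function $$f(x)=\begin{cases} ax+(a-b), & x\le -1,\\ bx, & -1<x<1,\\ ax+(b-a), & x\ge 1.\end{cases}$$ For $\mu\in\mathbb{R}$, consider the scalar $2\pi$-periodic differential equation $x'=f(x)+\mu\sin t$; let $u(t,\tau,x)$ be its solution with $u(\tau,\tau,x)=x$ (defined for all $t$), $P(x)=u(2\pi,0,x)$ and $d(x)=P(x)-x$. "Periodic solution" means $2\pi$-periodic solution. A limit cycle is an isolated periodic solution, i.e. one whose value at $t=0$ is an isolated zero of $d$; a periodic solution $u(t,0,\bar x)$ is hyperbolic if $P'(\bar x)\ne 1$. A periodic solution $u(t,0,x)$ is symmetric if $-u(\pi,0,x)=x$, equivalently $u(t+\pi,0,x)=-u(t,0,x)$ for all $t$. *)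

theory Defs
  imports "HOL-Analysis.Analysis"
begin

definition pwl :: "real \<Rightarrow> real \<Rightarrow> real \<Rightarrow> real" where
  "pwl a b x =
     (if x \<le> -1 then a * x + (a - b)
      else if x < 1 then b * x
      else a * x + (b - a))"

definition is_solution :: "real \<Rightarrow> real \<Rightarrow> real \<Rightarrow> (real \<Rightarrow> real) \<Rightarrow> bool" where
  "is_solution a b \<mu> v \<longleftrightarrow>
     (\<forall>t. (v has_real_derivative (pwl a b (v t) + \<mu> * sin t)) (at t))"

text \<open>
  The description below denotes a unique function: the right-hand side is continuous in time and
  globally Lipschitz in the state, so every initial value problem has exactly one solution on the
  whole real line. The argument order of \<open>flow\<close> after the parameters is: time, initial time,
  initial value.
\<close>

definition flow :: "real \<Rightarrow> real \<Rightarrow> real \<Rightarrow> real \<Rightarrow> real \<Rightarrow> real \<Rightarrow> real" where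
  "flow a b \<mu> t \<tau> x = (THE v. is_solution a b \<mu> v \<and> v \<tau> = x) t"

definition poincare :: "real \<Rightarrow> real \<Rightarrow> real \<Rightarrow> real \<Rightarrow> real" where
  "poincare a b \<mu> x = flow a b \<mu> (2 * pi) 0 x"

definition displacement :: "real \<Rightarrow> real \<Rightarrow> real \<Rightarrow> real \<Rightarrow> real" where
  "displacement a b \<mu> x = poincare a b \<mu> x - x"

definition periodic_solution :: "real \<Rightarrow> real \<Rightarrow> real \<Rightarrow> (real \<Rightarrow> real) \<Rightarrow> bool" where
  "periodic_solution a b \<mu> v \<longleftrightarrow> is_solution a b \<mu> v \<and> (\<forall>t. v (t + 2 * pi) = v t)"

definition limit_cycle :: "real \<Rightarrow> real \<Rightarrow> real \<Rightarrow> (real \<Rightarrow> real) \<Rightarrow> bool" where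
  "limit_cycle a b \<mu> v \<longleftrightarrow>
     periodic_solution a b \<mu> v \<and> v 0 isolated_in {x. displacement a b \<mu> x = 0}"

text \<open>
  The next two notions concern the solution with value \<open>x\<close> at time \<open>0\<close>. Hyperbolicity includes
  the differentiability of the Poincare map, since \<open>deriv\<close> is unspecified otherwise.
\<close>

definition symmetric_at :: "real \<Rightarrow> real \<Rightarrow> real \<Rightarrow> real \<Rightarrow> bool" where
  "symmetric_at a b \<mu> x \<longleftrightarrow> - flow a b \<mu> pi 0 x = x"

definition hyperbolic_at :: "real \<Rightarrow> real \<Rightarrow> real \<Rightarrow> real \<Rightarrow> bool" where
  "hyperbolic_at a b \<mu> x \<longleftrightarrow>
     poincare a b \<mu> field_differentiable (at x) \<and> deriv (poincare a b \<mu>) x \<noteq> 1"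

text \<open>
  Lyapunov stability of a solution \<open>v\<close> with respect to perturbations at time \<open>\<tau>\<close>. By continuous
  dependence on initial values it does not depend on \<open>\<tau>\<close>, so quantifying over all \<open>\<tau>\<close> in both
  the stability and the instability notion keeps them complementary.
\<close>

definition stable_from :: "real \<Rightarrow> real \<Rightarrow> real \<Rightarrow> real \<Rightarrow> (real \<Rightarrow> real) \<Rightarrow> bool" where
  "stable_from a b \<mu> \<tau> v \<longleftrightarrow>
     (\<forall>\<epsilon>>0. \<exists>\<delta>>0. \<forall>y. \<bar>y - v \<tau>\<bar> < \<delta> \<longrightarrow>
        (\<forall>t\<ge>\<tau>. \<bar>flow a b \<mu> t \<tau> y - v t\<bar> < \<epsilon>))"

definition globally_asymptotically_stable ::
    "real \<Rightarrow> real \<Rightarrow> real \<Rightarrow> (real \<Rightarrow> real) \<Rightarrow> bool" where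
  "globally_asymptotically_stable a b \<mu> v \<longleftrightarrow>
     (\<forall>\<tau>. stable_from a b \<mu> \<tau> v \<and>
        (\<forall>y. ((\<lambda>t. flow a b \<mu> t \<tau> y - v t) \<longlongrightarrow> 0) at_top))"

definition unstable :: "real \<Rightarrow> real \<Rightarrow> real \<Rightarrow> (real \<Rightarrow> real) \<Rightarrow> bool" where
  "unstable a b \<mu> v \<longleftrightarrow> (\<forall>\<tau>. \<not> stable_from a b \<mu> \<tau> v)"

end

(* Reversing time exchanges (a, b) and (-a, -b), so let a < 0 < b. Write p for the periodic solution
   of x' = a x + sin t. Every solution ends up in a tube around \<mu> p whose radius does not depend on
   \<mu>, and the tube is forward invariant; since p (t + pi) = - p t, the map sending x to minus the
   value at time pi of the solution through x maps the slice of the tube at time 0 into itself, and a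
   fixed point of it is a symmetric periodic solution.
   For large \<mu>, the strip where f expands is visited by the tube only while |a sin t + cos t| is
   small. A periodic weight exp (a \<psi>), with \<psi> bounded by pi / 2 but very steep at these times, absorbs
   that expansion: the weighted squared distance of two solutions in the tube decays like exp (a t).
   This gives uniqueness, stability and the bound exp (a pi) < 1 for the square of the derivative of
   the Poincare map. *)

theory Submission
  imports Defs
begin

section \<open>Global solutions of scalar Lipschitz equations\<close>

text \<open>Both \<open>k - h\<close> and \<open>k + h\<close> are nondecreasing. This plays the
  role of bounding an integral by the integral of a majorant, for either order of \<open>s\<close>
  and \<open>t\<close>.\<close>

lemma abs_diff_le_abs_diff_of_deriv:
  fixes h k :: "real \<Rightarrow> real"
  assumes h: "\<And>t. (h has_real_derivative h' t) (at t)"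
    and k: "\<And>t. (k has_real_derivative k' t) (at t)"
    and le: "\<And>t. \<bar>h' t\<bar> \<le> k' t"
  shows "\<bar>h t - h s\<bar> \<le> \<bar>k t - k s\<bar>"
proof -
  have less: "\<bar>h t - h s\<bar> \<le> k t - k s" if "s \<le> t" for s t
  proof -
    have "k s - h s \<le> k t - h t"
    proof (rule DERIV_nonneg_imp_nondecreasing[OF that])
      fix y show "\<exists>d. ((\<lambda>t. k t - h t) has_real_derivative d) (at y) \<and> 0 \<le> d"
        using h[of y] k[of y] le[of y] by (intro exI[of _ "k' y - h' y"]) (auto intro!: derivative_eq_intros)
    qed
    moreover have "k s + h s \<le> k t + h t"
    proof (rule DERIV_nonneg_imp_nondecreasing[OF that])
      fix y show "\<exists>d. ((\<lambda>t. k t + h t) has_real_derivative d) (at y) \<and> 0 \<le> d"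
        using h[of y] k[of y] le[of y] by (intro exI[of _ "k' y + h' y"]) (auto intro!: derivative_eq_intros)
    qed
    ultimately show ?thesis by linarith
  qed
  show ?thesis using less[of s t] less[of t s] by linarith
qed

lemma abs_sinh_le_cosh: "\<bar>sinh x\<bar> \<le> cosh (x::real)"
  using sinh_le_cosh_real[of x] sinh_le_cosh_real[of "-x"] by (simp add: abs_le_iff)

lemma ex_antiderivative_with_value:
  fixes h :: "real \<Rightarrow> real"
  assumes "continuous_on UNIV h"
  shows "\<exists>H. (\<forall>t. (H has_real_derivative h t) (at t)) \<and> H \<tau> = x"
proof -
  have "\<exists>F. \<forall>x::real. (-\<infinity>::ereal) < ereal x \<longrightarrow> ereal x < \<infinity> \<longrightarrow> (F has_vector_derivative h x) (at x)"
    by (rule einterval_antiderivative)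
      (use assms in \<open>auto simp: continuous_on_eq_continuous_at\<close>)
  then obtain F where F: "\<And>t. (F has_real_derivative h t) (at t)"
    by (auto simp: has_real_derivative_iff_has_vector_derivative)
  show ?thesis
    by (rule exI[of _ "\<lambda>t. F t - F \<tau> + x"]) (auto intro!: derivative_eq_intros F)
qed

text \<open>Picard iteration in the weight \<open>cosh (c (t - \<tau>))\<close>, for which the integral operator
  contracts by the factor \<open>L / c\<close> on the whole line at once.\<close>

lemma lipschitz_ode_solution_exists:
  fixes F :: "real \<Rightarrow> real \<Rightarrow> real"
  assumes cont: "\<And>g. continuous_on UNIV g \<Longrightarrow> continuous_on UNIV (\<lambda>t. F t (g t))"
    and lip: "\<And>t x y. \<bar>F t x - F t y\<bar> \<le> L * \<bar>x - y\<bar>"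
    and bdd: "\<And>t. \<bar>F t 0\<bar> \<le> M"
    and L: "L \<ge> 0"
  shows "\<exists>v. (\<forall>t. (v has_real_derivative F t (v t)) (at t)) \<and> v \<tau> = x"
proof -
  \<comment> \<open>With this rate the contraction factor \<open>L / l\<close> is at most 1/2, and
    \<open>l\<close> is positive even for \<open>L = 0\<close>.\<close>
  define l where "l = 2 * L + 1"
  have l: "l > 0" "L / l \<le> 1 / 2" using L by (auto simp: l_def field_simps)
  define c where "c t = cosh (l * (t - \<tau>))" for t
  define s where "s t = sinh (l * (t - \<tau>)) / l" for t
  have c1: "c t \<ge> 1" for t unfolding c_def by (rule cosh_real_ge_1)
  have cpos: "c t > 0" for t using c1[of t] by linarith
  have s: "(s has_real_derivative c t) (at t)" for t
    unfolding s_def c_def using l by (auto intro!: derivative_eq_intros)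
  have s0: "s \<tau> = 0" by (simp add: s_def)
  have sc: "\<bar>s t\<bar> \<le> c t / l" for t
    using abs_sinh_le_cosh[of "l * (t - \<tau>)"] l
    by (simp add: s_def c_def abs_divide divide_right_mono)
  have cc: "continuous_on UNIV c" unfolding c_def by (intro continuous_intros)
  have M0: "M \<ge> 0" using bdd[of 0] by linarith
  \<comment> \<open>\<open>H g\<close> is the Picard image of the function \<open>c * g\<close>. The
    iteration acts on quotients by the weight, which are bounded although solutions may grow
    exponentially.\<close>
  have "\<forall>g :: real \<Rightarrow>\<^sub>C real. \<exists>H. (\<forall>t. (H has_real_derivative F t (c t * g t)) (at t)) \<and> H \<tau> = x"
    by (intro allI ex_antiderivative_with_value cont continuous_intros cc) auto
  then obtain H where
    H: "\<And>g t. (H g has_real_derivative F t (c t * apply_bcontfun g t)) (at t)" and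
    Hx: "\<And>g. H g \<tau> = x" by metis
  define T where "T g = Bcontfun (\<lambda>t. H g t / c t)" for g
  have bound: "\<bar>H g t / c t\<bar> \<le> \<bar>x\<bar> + (M + L * norm g) / l" for g t
  proof -
    let ?K = "M + L * norm g"
    have K0: "?K \<ge> 0" using M0 L by simp
    have d: "\<bar>F t (c t * g t)\<bar> \<le> ?K * c t" for t
    proof -
      have "\<bar>F t (c t * g t)\<bar> \<le> M + L * \<bar>c t * g t\<bar>"
        using lip[of t "c t * g t" 0] bdd[of t] by simp
      also have "\<dots> \<le> M * c t + L * (c t * norm g)"
      proof (rule add_mono)
        show "M \<le> M * c t" using mult_left_mono[OF c1[of t] M0] by simp
        show "L * \<bar>c t * g t\<bar> \<le> L * (c t * norm g)"
          using norm_bounded[of g t] cpos[of t] by (intro mult_left_mono L) (simp add: abs_mult)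
      qed
      finally show ?thesis by (simp add: algebra_simps)
    qed
    have "\<bar>H g t - H g \<tau>\<bar> \<le> \<bar>?K * s t - ?K * s \<tau>\<bar>"
      by (rule abs_diff_le_abs_diff_of_deriv[OF H DERIV_cmult[OF s] d])
    also have "\<dots> = ?K * \<bar>s t\<bar>" using K0 by (simp add: s0 abs_mult)
    also have "\<dots> \<le> ?K * (c t / l)" by (rule mult_left_mono[OF sc K0])
    finally have "\<bar>H g t\<bar> \<le> \<bar>x\<bar> + ?K * (c t / l)" using Hx by auto
    also have "\<dots> \<le> \<bar>x\<bar> * c t + ?K * (c t / l)"
      using mult_left_mono[OF c1[of t], of "\<bar>x\<bar>"] by simp
    also have "\<dots> = (\<bar>x\<bar> + ?K / l) * c t" by (simp add: algebra_simps add_divide_distrib)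
    finally show ?thesis using cpos[of t] by (simp add: abs_divide pos_divide_le_eq)
  qed
  have Hc: "continuous_on UNIV (H g)" for g
    using H[of g] by (auto intro!: continuous_at_imp_continuous_on DERIV_isCont)
  have Tin: "(\<lambda>t. H g t / c t) \<in> bcontfun" for g
  proof (rule bcontfun_normI)
    show "continuous_on UNIV (\<lambda>t. H g t / c t)"
      using cpos by (intro continuous_intros Hc cc) (metis less_irrefl)
    show "norm (H g t / c t) \<le> \<bar>x\<bar> + (M + L * norm g) / l" for t
      using bound[of g t] by simp
  qed
  have T: "apply_bcontfun (T g) t = H g t / c t" for g t
    unfolding T_def using Bcontfun_inverse[OF Tin] by simp
  have contr: "dist (T g1) (T g2) \<le> 1 / 2 * dist g1 g2" for g1 g2
  proof (rule dist_bound)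
    fix t
    let ?K = "L * dist g1 g2"
    have K0: "?K \<ge> 0" using L by simp
    have d: "\<bar>F t (c t * g1 t) - F t (c t * g2 t)\<bar> \<le> ?K * c t" for t
    proof -
      have "\<bar>F t (c t * g1 t) - F t (c t * g2 t)\<bar> \<le> L * \<bar>c t * g1 t - c t * g2 t\<bar>" by (rule lip)
      also have "\<bar>c t * g1 t - c t * g2 t\<bar> = c t * dist (g1 t) (g2 t)"
        using cpos[of t] by (simp add: dist_real_def abs_mult flip: right_diff_distrib)
      also have "L * \<dots> \<le> L * (c t * dist g1 g2)"
        using dist_bounded[of g1 t g2] L cpos[of t] by (intro mult_left_mono) auto
      finally show ?thesis by (simp add: algebra_simps)
    qed
    have "\<bar>(H g1 t - H g2 t) - (H g1 \<tau> - H g2 \<tau>)\<bar> \<le> \<bar>?K * s t - ?K * s \<tau>\<bar>"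
      by (rule abs_diff_le_abs_diff_of_deriv[OF DERIV_diff[OF H H] DERIV_cmult[OF s] d])
    also have "\<dots> = ?K * \<bar>s t\<bar>" using L by (simp add: s0 abs_mult)
    also have "\<dots> \<le> ?K * (c t / l)" by (rule mult_left_mono[OF sc K0])
    also have "\<dots> = L / l * dist g1 g2 * c t" by simp
    also have "\<dots> \<le> 1 / 2 * dist g1 g2 * c t"
      using l cpos[of t] by (intro mult_right_mono) auto
    finally have "\<bar>H g1 t - H g2 t\<bar> \<le> 1 / 2 * dist g1 g2 * c t" by (simp add: Hx)
    then have "\<bar>H g1 t - H g2 t\<bar> / c t \<le> 1 / 2 * dist g1 g2"
      using cpos[of t] by (simp add: pos_divide_le_eq)
    then show "dist (T g1 t) (T g2 t) \<le> 1 / 2 * dist g1 g2"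
      using cpos[of t] by (simp add: T dist_real_def abs_divide flip: diff_divide_distrib)
  qed
  have "\<exists>!g. T g = g"
    by (rule banach_fix_type[where c = "1/2"]) (simp_all only: contr, simp_all)
  then obtain g where g: "T g = g" by auto
  have "c t * g t = H g t" for t
    using T[of g t] cpos[of t] by (simp add: g field_simps)
  with H[of g] Hx[of g] show ?thesis by (intro exI[of _ "H g"]) simp
qed

section \<open>The piecewise linear equation and its flow\<close>

text \<open>Splits the field into a linear part and a clamp. Boundedness of the clamp gives the tube
  around the linear response, and its constancy beyond each corner gives the contraction.\<close>

lemma pwl_eq_clamp: "pwl a b x = a * x + (b - a) * max (-1) (min 1 x)"
  by (auto simp: pwl_def max_def min_def algebra_simps)

lemma pwl_uminus: "pwl a b (- x) = - pwl a b x"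
proof -
  have "max (-1) (min 1 (- x)) = - max (-1) (min 1 x)" by (auto simp: max_def min_def)
  then show ?thesis by (simp add: pwl_eq_clamp algebra_simps)
qed

lemma pwl_lipschitz: "\<bar>pwl a b x - pwl a b y\<bar> \<le> (\<bar>a\<bar> + \<bar>b - a\<bar>) * \<bar>x - y\<bar>"
proof -
  have "pwl a b x - pwl a b y =
      a * (x - y) + (b - a) * (max (-1) (min 1 x) - max (-1) (min 1 y))"
    by (simp add: pwl_eq_clamp algebra_simps)
  also have "\<bar>\<dots>\<bar> \<le> \<bar>a\<bar> * \<bar>x - y\<bar> + \<bar>b - a\<bar> * \<bar>max (-1) (min 1 x) - max (-1) (min 1 y)\<bar>"
    by (metis abs_mult abs_triangle_ineq)
  also have "\<dots> \<le> \<bar>a\<bar> * \<bar>x - y\<bar> + \<bar>b - a\<bar> * \<bar>x - y\<bar>"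
    by (intro add_left_mono mult_left_mono) (auto simp: max_def min_def)
  finally show ?thesis by (simp add: algebra_simps)
qed

lemma continuous_on_pwl [continuous_intros]:
  "continuous_on S g \<Longrightarrow> continuous_on S (\<lambda>t. pwl a b (g t))"
  unfolding pwl_eq_clamp by (intro continuous_intros)

lemma is_solution_exists: "\<exists>v. is_solution a b \<mu> v \<and> v \<tau> = x"
  unfolding is_solution_def
proof (rule lipschitz_ode_solution_exists)
  show "continuous_on UNIV (\<lambda>t. pwl a b (g t) + \<mu> * sin t)"
    if "continuous_on UNIV g" for g using that by (intro continuous_intros)
  show "\<bar>pwl a b x + \<mu> * sin t - (pwl a b y + \<mu> * sin t)\<bar> \<le> (\<bar>a\<bar> + \<bar>b - a\<bar>) * \<bar>x - y\<bar>" for t x y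
    using pwl_lipschitz[of a b x y] by simp
  show "\<bar>pwl a b 0 + \<mu> * sin t\<bar> \<le> \<bar>\<mu>\<bar>" for t
    by (simp add: pwl_def abs_mult mult_left_le)
qed simp

text \<open>Gronwall's inequality in both time directions. The square of the difference is used
  because it is differentiable; multiplied by a suitable exponential it is monotone.\<close>

lemma solutions_diff_growth:
  assumes u: "is_solution a b \<mu> u" and v: "is_solution a b \<mu> v"
  shows "\<bar>u t - v t\<bar> \<le> \<bar>u s - v s\<bar> * exp ((\<bar>a\<bar> + \<bar>b - a\<bar>) * \<bar>t - s\<bar>)"
proof -
  define L where "L = \<bar>a\<bar> + \<bar>b - a\<bar>"
  define w where "w t = u t - v t" for t
  define w' where "w' t = pwl a b (u t) - pwl a b (v t)" for t
  have w: "(w has_real_derivative w' t) (at t)" for t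
    using u v unfolding w_def w'_def is_solution_def by (auto intro!: derivative_eq_intros)
  have ww: "\<bar>w t * w' t\<bar> \<le> L * (w t)\<^sup>2" for t
  proof -
    have "\<bar>w t * w' t\<bar> \<le> \<bar>w t\<bar> * (L * \<bar>w t\<bar>)"
      using pwl_lipschitz[of a b "u t" "v t"]
      by (auto simp: abs_mult w_def w'_def L_def intro!: mult_left_mono)
    also have "\<dots> = L * (w t)\<^sup>2"
      by (metis mult.left_commute power2_abs power2_eq_square)
    finally show ?thesis .
  qed
  have mono: "(w t)\<^sup>2 \<le> (w s)\<^sup>2 * exp (2 * L * \<bar>t - s\<bar>)"
  proof (cases "s \<le> t")
    case True
    have "(w t)\<^sup>2 * exp (- 2 * L * t) \<le> (w s)\<^sup>2 * exp (- 2 * L * s)"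
    proof (rule DERIV_nonpos_imp_nonincreasing[OF True])
      fix y
      show "\<exists>d. ((\<lambda>t. (w t)\<^sup>2 * exp (- 2 * L * t)) has_real_derivative d) (at y) \<and> d \<le> 0"
      proof (intro exI conjI)
        show "((\<lambda>t. (w t)\<^sup>2 * exp (- 2 * L * t)) has_real_derivative
            2 * (w y * w' y - L * (w y)\<^sup>2) * exp (- 2 * L * y)) (at y)"
          by (rule derivative_eq_intros w refl | simp add: algebra_simps power2_eq_square)+
        show "2 * (w y * w' y - L * (w y)\<^sup>2) * exp (- 2 * L * y) \<le> 0"
          using abs_le_D1[OF ww[of y]] by (simp add: mult_nonpos_nonneg)
      qed
    qed
    from mult_right_mono[OF this, of "exp (2 * L * t)"] True show ?thesis
      by (simp add: mult.assoc algebra_simps flip: exp_add)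
  next
    case False
    then have ts: "t \<le> s" by simp
    have "(w t)\<^sup>2 * exp (2 * L * t) \<le> (w s)\<^sup>2 * exp (2 * L * s)"
    proof (rule DERIV_nonneg_imp_nondecreasing[OF ts])
      fix y
      show "\<exists>d. ((\<lambda>t. (w t)\<^sup>2 * exp (2 * L * t)) has_real_derivative d) (at y) \<and> 0 \<le> d"
      proof (intro exI conjI)
        show "((\<lambda>t. (w t)\<^sup>2 * exp (2 * L * t)) has_real_derivative
            2 * (w y * w' y + L * (w y)\<^sup>2) * exp (2 * L * y)) (at y)"
          by (rule derivative_eq_intros w refl | simp add: algebra_simps power2_eq_square)+
        show "0 \<le> 2 * (w y * w' y + L * (w y)\<^sup>2) * exp (2 * L * y)"
          using abs_le_D2[OF ww[of y]] by simp
      qed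
    qed
    from mult_right_mono[OF this, of "exp (- 2 * L * t)"] False show ?thesis
      by (simp add: mult.assoc algebra_simps flip: exp_add)
  qed
  have "\<bar>w t\<bar> \<le> \<bar>w s\<bar> * exp (L * \<bar>t - s\<bar>)"
  proof (rule power2_le_imp_le)
    show "\<bar>w t\<bar>\<^sup>2 \<le> (\<bar>w s\<bar> * exp (L * \<bar>t - s\<bar>))\<^sup>2"
      using mono by (simp add: power_mult_distrib mult.assoc flip: exp_double)
  qed simp
  then show ?thesis by (simp add: w_def L_def)
qed

lemma solution_unique:
  assumes "is_solution a b \<mu> u" "is_solution a b \<mu> v" "u s = v s"
  shows "u = v"
  using solutions_diff_growth[OF assms(1,2), of _ s] assms(3) by (auto intro!: ext)

lemma flow_is_solution: "is_solution a b \<mu> (\<lambda>t. flow a b \<mu> t \<tau> x)"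
  and flow_initial: "flow a b \<mu> \<tau> \<tau> x = x"
proof -
  have ex1: "\<exists>!v. is_solution a b \<mu> v \<and> v \<tau> = x"
    using is_solution_exists[of a b \<mu> \<tau> x] solution_unique by metis
  from theI'[OF ex1] show "is_solution a b \<mu> (\<lambda>t. flow a b \<mu> t \<tau> x)" "flow a b \<mu> \<tau> \<tau> x = x"
    unfolding flow_def by auto
qed

lemma flow_eq:
  assumes "is_solution a b \<mu> v" "v \<tau> = x"
  shows "flow a b \<mu> t \<tau> x = v t"
  using solution_unique[OF flow_is_solution[of a b \<mu> \<tau> x] assms(1), of \<tau>] assms(2)
  by (metis flow_initial)

section \<open>Period shift, half shift and time reversal\<close>

lemma is_solution_shift:
  assumes "is_solution a b \<mu> v" shows "is_solution a b \<mu> (\<lambda>t. v (t + 2 * pi))"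
  unfolding is_solution_def
proof
  fix t
  have "(v has_real_derivative pwl a b (v (t + 2 * pi)) + \<mu> * sin (t + 2 * pi)) (at (t + 2 * pi))"
    using assms by (simp only: is_solution_def)
  then show "((\<lambda>t. v (t + 2 * pi)) has_real_derivative
      pwl a b (v (t + 2 * pi)) + \<mu> * sin t) (at t)"
    by (simp only: DERIV_shift sin_periodic)
qed

text \<open>The field is odd and \<open>sin (t + pi) = - sin t\<close>. Symmetric periodic solutions
  are the fixed points of this operation.\<close>

lemma is_solution_half_shift:
  assumes "is_solution a b \<mu> v" shows "is_solution a b \<mu> (\<lambda>t. - v (t + pi))"
  unfolding is_solution_def
proof
  fix t
  have "((\<lambda>t. v (t + pi)) has_real_derivative pwl a b (v (t + pi)) + \<mu> * sin (t + pi)) (at t)"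
    using assms by (simp only: DERIV_shift[symmetric] is_solution_def)
  from DERIV_minus[OF this]
  show "((\<lambda>t. - v (t + pi)) has_real_derivative pwl a b (- v (t + pi)) + \<mu> * sin t) (at t)"
    by (rule DERIV_cong) (simp add: pwl_uminus)
qed

text \<open>Reversal negates the derivative, but \<open>sin\<close> is odd, so the forcing keeps its
  sign while \<open>a\<close> and \<open>b\<close> change theirs.\<close>

lemma is_solution_reverse:
  assumes "is_solution a b \<mu> v" shows "is_solution (-a) (-b) \<mu> (\<lambda>t. v (- t))"
  unfolding is_solution_def
proof
  fix t
  have "(v has_real_derivative pwl a b (v (-t)) + \<mu> * sin (-t)) (at (- t))"
    using assms by (simp only: is_solution_def)
  then have "((\<lambda>t. v (- t)) has_real_derivative - (pwl a b (v (-t)) + \<mu> * sin (-t))) (at t)"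
    by (simp only: DERIV_mirror)
  then show "((\<lambda>t. v (- t)) has_real_derivative pwl (-a) (-b) (v (- t)) + \<mu> * sin t) (at t)"
    by (rule DERIV_cong) (auto simp: pwl_def)
qed

lemma flow_reverse: "flow (-a) (-b) \<mu> t \<tau> x = flow a b \<mu> (-t) (-\<tau>) x"
  by (rule flow_eq[OF is_solution_reverse[OF flow_is_solution]]) (simp add: flow_initial)

lemma periodic_iff_displacement_zero:
  assumes "is_solution a b \<mu> v"
  shows "periodic_solution a b \<mu> v \<longleftrightarrow> displacement a b \<mu> (v 0) = 0"
proof
  assume "periodic_solution a b \<mu> v"
  then have "v (0 + 2 * pi) = v 0" by (simp only: periodic_solution_def)
  then show "displacement a b \<mu> (v 0) = 0"
    by (simp add: displacement_def poincare_def flow_eq[OF assms refl])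
next
  assume "displacement a b \<mu> (v 0) = 0"
  then have "v (0 + 2 * pi) = v 0"
    by (simp add: displacement_def poincare_def flow_eq[OF assms refl])
  then have "(\<lambda>t. v (t + 2 * pi)) = v"
    by (rule solution_unique[OF is_solution_shift[OF assms] assms])
  then show "periodic_solution a b \<mu> v"
    using assms by (auto simp: periodic_solution_def dest: fun_cong)
qed

section \<open>The attracting tube around the linear response\<close>

text \<open>The periodic solution of \<open>x' = a x + sin t\<close>.\<close>

definition linear_response :: "real \<Rightarrow> real \<Rightarrow> real" where
  "linear_response a t = - (a * sin t + cos t) / (1 + a\<^sup>2)"

lemma one_plus_square_pos: "1 + a\<^sup>2 > (0::real)"
  by (rule add_pos_nonneg) auto

lemma linear_response_deriv:
  "(linear_response a has_real_derivative (a * linear_response a t + sin t)) (at t)"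
proof -
  have "(linear_response a has_real_derivative (- (a * cos t - sin t) / (1 + a\<^sup>2))) (at t)"
    unfolding linear_response_def
    by (intro DERIV_cdivide) (auto intro!: derivative_eq_intros)
  moreover have "- (a * cos t - sin t) / (1 + a\<^sup>2) = a * linear_response a t + sin t"
  proof -
    have "- (a * cos t - sin t) = a * (- (a * sin t + cos t)) + sin t * (1 + a\<^sup>2)"
      by (simp add: algebra_simps power2_eq_square)
    then show ?thesis
      by (simp only: linear_response_def add_divide_distrib times_divide_eq_right
          nonzero_mult_div_cancel_right[OF one_plus_square_pos[THEN less_imp_neq, THEN not_sym]])
  qed
  ultimately show ?thesis by simp
qed

lemma linear_response_pi: "linear_response a pi = - linear_response a 0"
  by (simp add: linear_response_def)

lemma linear_response_periodic: "linear_response a (t + 2 * pi) = linear_response a t"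
  by (simp add: linear_response_def sin_periodic cos_periodic)

text \<open>Variation of constants: the distance satisfies \<open>z' = a z + (b - a) cl\<close> with
  \<open>cl\<close> bounded by 1. The forcing has cancelled, so the bound is a convex combination of
  the initial distance and a radius free of \<mu>.\<close>

lemma distance_to_linear_response:
  assumes a: "a < 0" and ab: "a \<le> b" and v: "is_solution a b \<mu> v" and st: "s \<le> t"
  shows "\<bar>v t - \<mu> * linear_response a t\<bar> \<le>
    \<bar>v s - \<mu> * linear_response a s\<bar> * exp (a * (t - s)) + (b - a) / \<bar>a\<bar> * (1 - exp (a * (t - s)))"
proof -
  define z where "z t = v t - \<mu> * linear_response a t" for t
  \<comment> \<open>\<open>g\<close> is \<open>z\<close> times the integrating factor, and
    \<open>k\<close> is a primitive of the bound on the derivative of \<open>g\<close>.\<close>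
  define g where "g t = z t * exp (- a * t)" for t
  define k where "k t = (b - a) / (- a) * exp (- a * t)" for t
  define cl where "cl x = max (-1) (min 1 x)" for x :: real
  have z: "(z has_real_derivative (a * z t + (b - a) * cl (v t))) (at t)" for t
  proof -
    have "(z has_real_derivative (pwl a b (v t) + \<mu> * sin t)
        - \<mu> * (a * linear_response a t + sin t)) (at t)"
      using v unfolding z_def is_solution_def
      by (intro DERIV_diff DERIV_cmult linear_response_deriv) auto
    then show ?thesis
      by (rule DERIV_cong) (simp add: pwl_eq_clamp cl_def z_def algebra_simps)
  qed
  have g: "(g has_real_derivative ((b - a) * cl (v t) * exp (- a * t))) (at t)" for t
    unfolding g_def by (rule derivative_eq_intros z refl | simp add: algebra_simps)+
  have k: "(k has_real_derivative ((b - a) * exp (- a * t))) (at t)" for t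
    unfolding k_def using a by (auto intro!: derivative_eq_intros simp: field_simps)
  have "\<bar>g t - g s\<bar> \<le> \<bar>k t - k s\<bar>"
  proof (rule abs_diff_le_abs_diff_of_deriv[OF g k])
    fix t
    have "\<bar>cl (v t)\<bar> \<le> 1" by (auto simp: cl_def max_def min_def)
    then have "(b - a) * \<bar>cl (v t)\<bar> * exp (- a * t) \<le> (b - a) * 1 * exp (- a * t)"
      using ab by (intro mult_right_mono mult_left_mono) auto
    then show "\<bar>(b - a) * cl (v t) * exp (- a * t)\<bar> \<le> (b - a) * exp (- a * t)"
      using ab by (simp add: abs_mult)
  qed
  also have "k s \<le> k t"
    unfolding k_def using a ab st by (intro mult_left_mono) (auto simp: divide_nonneg_neg)
  then have "\<bar>k t - k s\<bar> = k t - k s" by simp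
  finally have "\<bar>g t\<bar> \<le> \<bar>g s\<bar> + (k t - k s)" by linarith
  then have "\<bar>g t\<bar> * exp (a * t) \<le> (\<bar>g s\<bar> + (k t - k s)) * exp (a * t)"
    by (intro mult_right_mono) auto
  moreover have "\<bar>g t\<bar> * exp (a * t) = \<bar>z t\<bar>"
    by (simp add: g_def abs_mult mult.assoc flip: exp_add)
  moreover have "\<bar>g s\<bar> * exp (a * t) = \<bar>z s\<bar> * exp (a * (t - s))"
    by (simp add: g_def abs_mult mult.assoc algebra_simps flip: exp_add)
  moreover have "(k t - k s) * exp (a * t) = (b - a) / \<bar>a\<bar> * (1 - exp (a * (t - s)))"
    using a by (simp add: k_def mult.assoc algebra_simps flip: exp_add)
  ultimately show ?thesis by (simp add: z_def distrib_right)
qed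

lemma linear_response_tube_invariant:
  assumes a: "a < 0" and ab: "a \<le> b" and v: "is_solution a b \<mu> v" and st: "s \<le> t"
    and R: "(b - a) / \<bar>a\<bar> \<le> R" and vs: "\<bar>v s - \<mu> * linear_response a s\<bar> \<le> R"
  shows "\<bar>v t - \<mu> * linear_response a t\<bar> \<le> R"
proof -
  define e where "e = exp (a * (t - s))"
  have e: "0 \<le> e" "e \<le> 1" using a st by (auto simp: e_def mult_nonpos_nonneg)
  have "\<bar>v t - \<mu> * linear_response a t\<bar> \<le>
      \<bar>v s - \<mu> * linear_response a s\<bar> * e + (b - a) / \<bar>a\<bar> * (1 - e)"
    unfolding e_def by (rule distance_to_linear_response[OF a ab v st])
  also have "\<dots> \<le> R * e + R * (1 - e)"
    using e by (intro add_mono mult_right_mono vs R) auto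
  finally show ?thesis by (simp add: algebra_simps)
qed

text \<open>The distance bound tends to the radius \<open>(b - a) / |a|\<close>; allowing 1 more
  makes a finite waiting time enough.\<close>

lemma linear_response_tube_attracting:
  assumes a: "a < 0" and ab: "a \<le> b" and v: "is_solution a b \<mu> v"
  obtains t where "t \<ge> s" "\<bar>v t - \<mu> * linear_response a t\<bar> \<le> (b - a) / \<bar>a\<bar> + 1"
proof -
  define z where "z = \<bar>v s - \<mu> * linear_response a s\<bar>"
  \<comment> \<open>By this time the decay factor is \<open>exp (- z)\<close>, and
    \<open>z * exp (- z)\<close> is at most 1.\<close>
  define t where "t = s + z / (- a)"
  have z: "z \<ge> 0" by (simp add: z_def)
  have t: "s \<le> t" using a z by (simp add: t_def divide_nonneg_neg)
  have e: "a * (t - s) = - z" using a by (simp add: t_def)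
  have "z * exp (- z) \<le> 1"
  proof -
    have "z \<le> exp z" using exp_ge_add_one_self[of z] by linarith
    then have "z * exp (- z) \<le> exp z * exp (- z)" by (intro mult_right_mono) auto
    then show ?thesis by (simp flip: exp_add)
  qed
  moreover have "(b - a) / \<bar>a\<bar> * (1 - exp (- z)) \<le> (b - a) / \<bar>a\<bar>"
    using ab by (intro mult_left_le) auto
  ultimately have "\<bar>v t - \<mu> * linear_response a t\<bar> \<le> (b - a) / \<bar>a\<bar> + 1"
    using distance_to_linear_response[OF a ab v t] by (simp add: e z_def)
  with t that show thesis by blast
qed

section \<open>Contraction inside the tube for large forcing\<close>

text \<open>The angle from \<open>(Q, S)\<close> to \<open>(Q, N S)\<close>. It is bounded by \<open>pi / 2\<close>, yet for large \<open>N\<close>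
  its derivative is large wherever \<open>S\<close> is small.\<close>

definition angle_gap :: "real \<Rightarrow> real \<Rightarrow> real \<Rightarrow> real" where
  "angle_gap N S Q = arctan ((N - 1) * S * Q / (Q\<^sup>2 + N * S\<^sup>2))"

text \<open>The angle of \<open>(Q, S)\<close> has speed 1 and that of \<open>(Q, N S)\<close> has
  speed \<open>N (S^2 + Q^2) / (Q^2 + N^2 S^2)\<close>; the result is their difference. The
  subtraction formula for the tangent gives the closed form, which is smooth also where
  \<open>Q\<close> vanishes.\<close>

lemma angle_gap_deriv:
  assumes S: "(S has_real_derivative Q t) (at t)" and Q: "(Q has_real_derivative - S t) (at t)"
    and pos: "(S t)\<^sup>2 + (Q t)\<^sup>2 > 0" and N: "N > 0"
  shows "((\<lambda>t. angle_gap N (S t) (Q t)) has_real_derivative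
    (N * ((S t)\<^sup>2 + (Q t)\<^sup>2) / ((Q t)\<^sup>2 + N\<^sup>2 * (S t)\<^sup>2) - 1)) (at t)"
proof -
  let ?s = "S t" and ?q = "Q t"
  let ?D = "?q\<^sup>2 + N * ?s\<^sup>2" and ?E = "?q\<^sup>2 + N\<^sup>2 * ?s\<^sup>2" and ?K = "?s\<^sup>2 + ?q\<^sup>2"
  have nz: "?s \<noteq> 0 \<or> ?q \<noteq> 0" using pos by auto
  have D: "?D > 0" and E: "?E > 0" using nz N by (auto simp: add_pos_nonneg add_nonneg_pos)
  let ?h = "(N - 1) * ?s * ?q / ?D"
  let ?h' = "(N - 1) * ((?q\<^sup>2 - ?s\<^sup>2) * ?D - 2 * (N - 1) * ?s\<^sup>2 * ?q\<^sup>2) / ?D\<^sup>2"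
  have h: "((\<lambda>t. (N - 1) * S t * Q t / ((Q t)\<^sup>2 + N * (S t)\<^sup>2)) has_real_derivative ?h') (at t)"
    using D by (auto intro!: derivative_eq_intros S Q simp: field_simps power2_eq_square)
  have "((\<lambda>t. angle_gap N (S t) (Q t)) has_real_derivative (inverse (1 + ?h\<^sup>2) * ?h')) (at t)"
    unfolding angle_gap_def by (rule DERIV_chain2[OF DERIV_arctan h])
  moreover have "inverse (1 + ?h\<^sup>2) * ?h' = N * ?K / ?E - 1"
  proof -
    have K: "?K \<noteq> 0" using pos by linarith
    have "1 + ?h\<^sup>2 = (?D\<^sup>2 + ((N - 1) * ?s * ?q)\<^sup>2) / ?D\<^sup>2"
      using D by (simp add: power_divide add_divide_distrib)
    \<comment> \<open>The two-square identity, that is, multiplicativity of the norm for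
      \<open>(Q + i S) (Q - i N S)\<close>.\<close>
    also have "?D\<^sup>2 + ((N - 1) * ?s * ?q)\<^sup>2 = ?K * ?E"
      by (simp add: algebra_simps power2_eq_square)
    finally have "inverse (1 + ?h\<^sup>2) = ?D\<^sup>2 / (?K * ?E)" by simp
    moreover have "(N - 1) * ((?q\<^sup>2 - ?s\<^sup>2) * ?D - 2 * (N - 1) * ?s\<^sup>2 * ?q\<^sup>2) = ?K * (N * ?K - ?E)"
      by (simp add: algebra_simps power2_eq_square)
    ultimately have "inverse (1 + ?h\<^sup>2) * ?h' = ?D\<^sup>2 / (?K * ?E) * (?K * (N * ?K - ?E) / ?D\<^sup>2)"
      by (simp only:)
    also have "\<dots> = (N * ?K - ?E) / ?E" using D K by simp
    also have "\<dots> = N * ?K / ?E - 1" using divide_self[of ?E] E by (simp only: diff_divide_distrib)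
    finally show ?thesis .
  qed
  ultimately show ?thesis by simp
qed

lemma abs_angle_gap_diff: "\<bar>angle_gap N S Q - angle_gap N S' Q'\<bar> \<le> pi"
  unfolding angle_gap_def using arctan_bounded by (smt (verit) field_sum_of_halves)

text \<open>The factors are the stretching parameter \<open>N\<close> of the angle gap, the tube
  radius plus 1 for the half width of the strip, and the denominator of the linear response. Beyond
  this value, \<open>N |a sin t + cos t|\<close> is below 1 whenever the tube can meet the
  strip.\<close>

definition forcing_threshold :: "real \<Rightarrow> real \<Rightarrow> real" where
  "forcing_threshold a b = (4 * (b - a) / \<bar>a\<bar> + 1) * ((b - a) / \<bar>a\<bar> + 2) * (1 + a\<^sup>2)"

text \<open>The square of the difference times \<open>exp (a (\<psi> t - t))\<close> is
  nonincreasing. Removing the weight costs at most a factor \<open>exp (- a pi)\<close>, so over a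
  full period the square still shrinks by \<open>exp (a pi)\<close>.\<close>

lemma solutions_in_tube_contract:
  assumes a: "a < 0" and b: "b > 0" and mu: "\<bar>\<mu>\<bar> > forcing_threshold a b"
    and u: "is_solution a b \<mu> u" and v: "is_solution a b \<mu> v" and st: "s \<le> t"
    and us: "\<bar>u s - \<mu> * linear_response a s\<bar> \<le> (b - a) / \<bar>a\<bar> + 1"
    and vs: "\<bar>v s - \<mu> * linear_response a s\<bar> \<le> (b - a) / \<bar>a\<bar> + 1"
  shows "(u t - v t)\<^sup>2 \<le> (u s - v s)\<^sup>2 * exp (a * (t - s - pi))"
proof -
  define r where "r = (b - a) / \<bar>a\<bar> + 1"
  \<comment> \<open>Chosen so that \<open>a (N / 2 - 2)\<close> is at most \<open>- 2 b\<close>,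
    which outweighs the expansion in the strip.\<close>
  define N where "N = 4 * (b - a) / \<bar>a\<bar> + 1"
  have r: "r \<ge> 0" "(b - a) / \<bar>a\<bar> \<le> r" and N: "N \<ge> 1"
    using a b by (auto simp: r_def N_def divide_nonneg_neg divide_nonpos_neg)
  have thr: "N * (r + 1) * (1 + a\<^sup>2) < \<bar>\<mu>\<bar>"
    using mu by (simp add: forcing_threshold_def N_def r_def add.assoc)
  define S where "S t = a * sin t + cos t" for t
  define Q where "Q t = a * cos t - sin t" for t
  define \<psi> where "\<psi> t = angle_gap N (S t) (Q t)" for t
  define \<psi>' where "\<psi>' t = N * (1 + a\<^sup>2) / ((Q t)\<^sup>2 + N\<^sup>2 * (S t)\<^sup>2) - 1" for t
  have K: "(S t)\<^sup>2 + (Q t)\<^sup>2 = 1 + a\<^sup>2" for t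
  proof -
    have "(S t)\<^sup>2 + (Q t)\<^sup>2 = (1 + a\<^sup>2) * ((sin t)\<^sup>2 + (cos t)\<^sup>2)"
      unfolding S_def Q_def by algebra
    then show ?thesis by simp
  qed
  have Kpos: "1 + a\<^sup>2 > 0" by (rule one_plus_square_pos)
  have \<psi>: "(\<psi> has_real_derivative \<psi>' t) (at t)" for t
  proof -
    have "(S has_real_derivative Q t) (at t)" "(Q has_real_derivative - S t) (at t)"
      unfolding S_def Q_def by (auto intro!: derivative_eq_intros)
    from angle_gap_deriv[OF this] show ?thesis
      using N Kpos by (simp add: K \<psi>_def [abs_def] \<psi>'_def)
  qed
  define w where "w t = u t - v t" for t
  define w' where "w' t = pwl a b (u t) - pwl a b (v t)" for t
  have w: "(w has_real_derivative w' t) (at t)" for t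
    using u v unfolding w_def w'_def is_solution_def by (auto intro!: derivative_eq_intros)
  \<comment> \<open>Up to a positive factor, this is the derivative of the weighted square
    \<open>V\<close> introduced below.\<close>
  have key: "2 * (w y * w' y) + a * (\<psi>' y - 1) * (w y)\<^sup>2 \<le> 0" if "s \<le> y" for y
  proof -
    have uy: "\<bar>u y - \<mu> * linear_response a y\<bar> \<le> r"
      using linear_response_tube_invariant[OF a _ u that r(2)] us a b by (simp add: r_def)
    have vy: "\<bar>v y - \<mu> * linear_response a y\<bar> \<le> r"
      using linear_response_tube_invariant[OF a _ v that r(2)] vs a b by (simp add: r_def)
    define cd where "cd = max (-1) (min 1 (u y)) - max (-1) (min 1 (v y))"
    have w'e: "w y * w' y = a * (w y)\<^sup>2 + (b - a) * (w y * cd)"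
      by (simp add: w_def w'_def pwl_eq_clamp cd_def algebra_simps power2_eq_square)
    have E0: "(Q y)\<^sup>2 + N\<^sup>2 * (S y)\<^sup>2 > 0"
    proof -
      have "S y \<noteq> 0 \<or> Q y \<noteq> 0" using K[of y] Kpos by auto
      then show ?thesis using N by (auto simp: add_pos_nonneg add_nonneg_pos)
    qed
    show ?thesis
    proof (cases "\<bar>\<mu> * linear_response a y\<bar> > r + 1")
      case True
      \<comment> \<open>Both solutions lie beyond the same corner, so the clamp takes the same value
        on both.\<close>
      then have "cd = 0" using uy vy by (auto simp: cd_def max_def min_def abs_if split: if_splits)
      then have "2 * (w y * w' y) + a * (\<psi>' y - 1) * (w y)\<^sup>2 = a * ((\<psi>' y + 1) * (w y)\<^sup>2)"
        unfolding w'e by (simp add: algebra_simps)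
      \<comment> \<open>\<open>\<psi>' + 1\<close> is the speed of the stretched angle, hence
        nonnegative.\<close>
      moreover have "\<psi>' y + 1 \<ge> 0" unfolding \<psi>'_def using N Kpos E0 by simp
      ultimately show ?thesis using a by (simp add: mult_nonpos_nonneg)
    next
      case False
      \<comment> \<open>The linear response is near the strip, so \<open>|S|\<close> is at most
        \<open>1 / N\<close>, and the stretched angle then turns with speed at least
        \<open>N / 2\<close>.\<close>
      have "\<bar>\<mu> * linear_response a y\<bar> = \<bar>\<mu>\<bar> * \<bar>S y\<bar> / (1 + a\<^sup>2)"
        unfolding linear_response_def S_def[symmetric] using Kpos by (simp add: abs_mult abs_divide)
      then have "\<bar>\<mu>\<bar> * \<bar>S y\<bar> / (1 + a\<^sup>2) \<le> r + 1" using False by linarith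
      then have "\<bar>\<mu>\<bar> * \<bar>S y\<bar> \<le> (r + 1) * (1 + a\<^sup>2)" using Kpos by (simp only: pos_divide_le_eq)
      then have "N * (\<bar>\<mu>\<bar> * \<bar>S y\<bar>) \<le> N * ((r + 1) * (1 + a\<^sup>2))" using N by (intro mult_left_mono) auto
      also have "\<dots> < \<bar>\<mu>\<bar>" using thr by (simp add: mult.assoc)
      finally have lt: "\<bar>\<mu>\<bar> * (N * \<bar>S y\<bar>) < \<bar>\<mu>\<bar>" by (simp add: algebra_simps)
      then have "\<bar>\<mu>\<bar> > 0" using N by (smt (verit) abs_ge_zero mult_nonneg_nonneg)
      with lt have "N * \<bar>S y\<bar> \<le> 1" by (simp add: mult_less_cancel_left1)
      then have "(N * \<bar>S y\<bar>)\<^sup>2 \<le> 1\<^sup>2" using N by (intro power_mono) auto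
      then have "N\<^sup>2 * (S y)\<^sup>2 \<le> 1" by (simp add: power_mult_distrib)
      moreover have "(Q y)\<^sup>2 \<le> 1 + a\<^sup>2" using K[of y] zero_le_power2[of "S y"] by linarith
      ultimately have "(Q y)\<^sup>2 + N\<^sup>2 * (S y)\<^sup>2 \<le> (1 + a\<^sup>2) + 1" by (intro add_mono)
      also have "\<dots> \<le> 2 * (1 + a\<^sup>2)" by simp
      finally have "(Q y)\<^sup>2 + N\<^sup>2 * (S y)\<^sup>2 \<le> 2 * (1 + a\<^sup>2)" .
      then have "N * (1 + a\<^sup>2) / (2 * (1 + a\<^sup>2)) \<le> N * (1 + a\<^sup>2) / ((Q y)\<^sup>2 + N\<^sup>2 * (S y)\<^sup>2)"
        using N Kpos E0 by (intro divide_left_mono) auto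
      moreover have "N * (1 + a\<^sup>2) / (2 * (1 + a\<^sup>2)) = N / 2"
        by (rule mult_divide_mult_cancel_right) (use Kpos in linarith)
      ultimately have "N / 2 - 2 \<le> \<psi>' y - 1" unfolding \<psi>'_def by linarith
      then have "a * (\<psi>' y - 1) \<le> a * (N / 2 - 2)" using a by simp
      also have "\<dots> \<le> - 2 * b" using a b by (simp add: N_def field_simps)
      finally have 1: "a * (\<psi>' y - 1) * (w y)\<^sup>2 \<le> - 2 * b * (w y)\<^sup>2" by (rule mult_right_mono) simp
      \<comment> \<open>The clamp is 1-Lipschitz, so the difference grows at rate at most
        \<open>b\<close>.\<close>
      have "w y * cd \<le> (w y)\<^sup>2"
      proof -
        have "\<bar>cd\<bar> \<le> \<bar>w y\<bar>" by (auto simp: cd_def w_def max_def min_def)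
        then have "\<bar>w y\<bar> * \<bar>cd\<bar> \<le> \<bar>w y\<bar> * \<bar>w y\<bar>" by (intro mult_left_mono) auto
        then have "\<bar>w y * cd\<bar> \<le> (w y)\<^sup>2" by (simp add: abs_mult power2_eq_square)
        then show ?thesis by linarith
      qed
      then have "(b - a) * (w y * cd) \<le> (b - a) * (w y)\<^sup>2" using a b by (intro mult_left_mono) auto
      then have "w y * w' y \<le> b * (w y)\<^sup>2" unfolding w'e by (simp add: algebra_simps)
      with 1 show ?thesis by linarith
    qed
  qed
  define V where "V t = (w t)\<^sup>2 * exp (a * (\<psi> t - t))" for t
  have "V t \<le> V s"
  proof (rule DERIV_nonpos_imp_nonincreasing[OF st])
    fix y assume y: "s \<le> y"
    have "(V has_real_derivative
        (2 * (w y * w' y) + a * (\<psi>' y - 1) * (w y)\<^sup>2) * exp (a * (\<psi> y - y))) (at y)"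
      unfolding V_def by (rule derivative_eq_intros w \<psi> refl | simp add: algebra_simps power2_eq_square)+
    moreover have "(2 * (w y * w' y) + a * (\<psi>' y - 1) * (w y)\<^sup>2) * exp (a * (\<psi> y - y)) \<le> 0"
      using key[OF y] by (simp add: mult_nonpos_nonneg)
    ultimately show "\<exists>d. (V has_real_derivative d) (at y) \<and> d \<le> 0" by blast
  qed
  then have "V t * exp (- a * (\<psi> t - t)) \<le> V s * exp (- a * (\<psi> t - t))"
    by (intro mult_right_mono) auto
  then have "(w t)\<^sup>2 \<le> (w s)\<^sup>2 * exp (a * (t - s) + a * (\<psi> s - \<psi> t))"
    by (simp add: V_def mult.assoc algebra_simps flip: exp_add)
  also have "\<dots> \<le> (w s)\<^sup>2 * exp (a * (t - s - pi))"
  proof -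
    have "- pi \<le> \<psi> s - \<psi> t"
      using abs_angle_gap_diff[of N "S s" "Q s" "S t" "Q t"] by (simp add: \<psi>_def)
    then have "a * (\<psi> s - \<psi> t) \<le> a * (- pi)" using a by (intro mult_left_mono_neg) auto
    then have "a * (t - s) + a * (\<psi> s - \<psi> t) \<le> a * (t - s - pi)" by (simp add: algebra_simps)
    then show ?thesis by (intro mult_left_mono) auto
  qed
  finally show ?thesis by (simp add: w_def)
qed

section \<open>Differentiability of the flow in its initial value\<close>

text \<open>Each such point is the only point of \<open>A\<close> in some member of a countable
  base, and this choice is injective.\<close>

lemma countable_isolated_points:
  fixes A :: "'a::second_countable_topology set"
  shows "countable {x \<in> A. \<not> x islimpt A}"
proof -
  obtain B :: "'a set set" where B: "countable B" "\<And>S. open S \<Longrightarrow> \<exists>U. U \<subseteq> B \<and> S = \<Union>U"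
    using univ_second_countable by metis
  have "\<exists>C\<in>B. x \<in> C \<and> A \<inter> C \<subseteq> {x}" if "\<not> x islimpt A" for x
  proof -
    from that obtain T where T: "x \<in> T" "open T" "\<forall>y\<in>A. y \<in> T \<longrightarrow> y = x"
      unfolding islimpt_def by blast
    with B(2)[OF T(2)] show ?thesis by blast
  qed
  then obtain f where f: "\<And>x. \<not> x islimpt A \<Longrightarrow> f x \<in> B \<and> x \<in> f x \<and> A \<inter> f x \<subseteq> {x}"
    by metis
  have "inj_on f {x \<in> A. \<not> x islimpt A}" by (rule inj_onI) (use f in blast)
  moreover have "countable (f ` {x \<in> A. \<not> x islimpt A})"
    by (rule countable_subset[OF _ B(1)]) (use f in blast)
  ultimately show ?thesis by (simp add: countable_image_inj_eq)
qed

text \<open>At a limit point of the level set the difference quotient vanishes along that set, so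
  the derivative is zero there. Regular points are therefore isolated.\<close>

lemma countable_regular_level_set:
  fixes g :: "real \<Rightarrow> real"
  assumes g: "\<And>t. (g has_real_derivative g' t) (at t)"
  shows "countable {t. g t = c \<and> g' t \<noteq> 0}"
proof -
  let ?A = "{t. g t = c}"
  have "g' t = 0" if t: "g t = c" "t islimpt ?A" for t
  proof -
    have "((\<lambda>y. (g y - g t) / (y - t)) \<longlongrightarrow> g' t) (at t within ?A)"
      using g[of t] unfolding has_field_derivative_iff by (rule tendsto_mono[OF at_le, rotated]) simp
    moreover have "((\<lambda>y. (g y - g t) / (y - t)) \<longlongrightarrow> 0) (at t within ?A)"
      using t(1) by (intro tendsto_eventually) (auto simp: eventually_at_filter)
    ultimately show ?thesis
      using t(2) tendsto_unique trivial_limit_within by metis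
  qed
  then have "{t. g t = c \<and> g' t \<noteq> 0} \<subseteq> {t \<in> ?A. \<not> t islimpt ?A}" by auto
  then show ?thesis using countable_isolated_points countable_subset by blast
qed

text \<open>Times of nonzero velocity are regular. Zero velocity at level \<open>c\<close> fixes the
  value of \<open>sin t\<close>, because \<mu> is nonzero; such times are countable by the same
  argument for \<open>sin\<close> and, at its critical points, for \<open>cos\<close>.\<close>

lemma countable_solution_level_set:
  assumes mu: "\<mu> \<noteq> 0" and v: "is_solution a b \<mu> v"
  shows "countable {t. v t = c}"
proof -
  have 1: "countable {t. v t = c \<and> pwl a b (v t) + \<mu> * sin t \<noteq> 0}"
    by (rule countable_regular_level_set) (use v in \<open>auto simp: is_solution_def\<close>)
  have 2: "countable {t::real. sin t = k \<and> cos t \<noteq> 0}" for k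
    by (rule countable_regular_level_set[OF DERIV_sin])
  have 3: "countable {t::real. cos t = 0 \<and> - sin t \<noteq> 0}"
    by (rule countable_regular_level_set[OF DERIV_cos])
  have "{t. v t = c} \<subseteq> {t. v t = c \<and> pwl a b (v t) + \<mu> * sin t \<noteq> 0} \<union>
      ({t. sin t = - pwl a b c / \<mu> \<and> cos t \<noteq> 0} \<union> {t. cos t = 0 \<and> - sin t \<noteq> 0})"
  proof
    fix t assume "t \<in> {t. v t = c}"
    moreover have "sin t = - pwl a b c / \<mu>" if "pwl a b c + \<mu> * sin t = 0"
      using that mu by (simp add: field_simps)
    moreover have "sin t \<noteq> 0" if "cos t = 0" using that sin_zero_abs_cos_one[of t] by auto
    ultimately show "t \<in> {t. v t = c \<and> pwl a b (v t) + \<mu> * sin t \<noteq> 0} \<union>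
        ({t. sin t = - pwl a b c / \<mu> \<and> cos t \<noteq> 0} \<union> {t. cos t = 0 \<and> - sin t \<noteq> 0})"
      by auto
  qed
  then show ?thesis using 1 2 3 countable_subset by (meson countable_Un)
qed

text \<open>Off the corners the sequence eventually stays in the linear piece of its limit, so the
  slopes become equal to the local one.\<close>

lemma pwl_secant_slope_eventually:
  assumes "X \<longlonglongrightarrow> x" "\<bar>x\<bar> \<noteq> 1" "\<And>n. X n \<noteq> x"
  shows "\<forall>\<^sub>F n in sequentially.
    (pwl a b (X n) - pwl a b x) / (X n - x) = (if \<bar>x\<bar> < 1 then b else a)"
proof -
  have "\<forall>\<^sub>F n in sequentially.
      pwl a b (X n) - pwl a b x = (if \<bar>x\<bar> < 1 then b else a) * (X n - x)"
  proof -
    consider "x < -1" | "-1 < x" "x < 1" | "1 < x" using assms(2) by linarith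
    then show ?thesis
    proof cases
      case 1
      from order_tendstoD(2)[OF assms(1) 1] show ?thesis
        by eventually_elim (use 1 in \<open>simp add: pwl_def algebra_simps\<close>)
    next
      case 2
      from order_tendstoD(1)[OF assms(1) 2(1)] order_tendstoD(2)[OF assms(1) 2(2)] show ?thesis
        by eventually_elim (use 2 in \<open>simp add: pwl_def abs_less_iff algebra_simps\<close>)
    next
      case 3
      from order_tendstoD(1)[OF assms(1) 3] show ?thesis
        by eventually_elim (use 3 in \<open>simp add: pwl_def algebra_simps\<close>)
    qed
  qed
  then show ?thesis by eventually_elim (simp add: assms(3))
qed

text \<open>The difference quotient of the flow is the exponential of the integral of the secant slopes
  of \<open>pwl\<close>, which converge except at the countably many times where the solution is at a corner.\<close>

lemma flow_differentiable_in_initial_value: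
  assumes mu: "\<mu> \<noteq> 0" and T: "0 \<le> T"
  shows "(\<lambda>y. flow a b \<mu> T 0 y) field_differentiable (at x)"
proof -
  define v where "v t = flow a b \<mu> t 0 x" for t
  have v: "is_solution a b \<mu> v" unfolding v_def by (rule flow_is_solution)
  have v0: "v 0 = x" by (simp add: v_def flow_initial)
  define C where "C = {t. v t = 1} \<union> {t. v t = -1}"
  have "countable C" unfolding C_def using countable_solution_level_set[OF mu v] by simp
  then have C: "negligible C"
    unfolding negligible_iff_null_sets
    by (intro null_sets_completionI countable_imp_null_set_lborel)
  have sol_cont: "continuous_on UNIV u" if "is_solution a b \<mu> u" for u
    using that unfolding is_solution_def
    by (intro continuous_at_imp_continuous_on ballI DERIV_isCont) auto
  define m where "m y t = (pwl a b (flow a b \<mu> t 0 y) - pwl a b (v t)) / (flow a b \<mu> t 0 y - v t)" for y t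
  define g where "g t = (if \<bar>v t\<bar> < 1 then b else a)" for t
  define D where "D = exp (integral ({0..T} - C) g)"
  \<comment> \<open>Distinct solutions never meet, so the denominator of \<open>m y\<close> has no
    zero.\<close>
  have ne: "flow a b \<mu> t 0 y \<noteq> v t" if "y \<noteq> x" for y t
  proof
    assume "flow a b \<mu> t 0 y = v t"
    from fun_cong[OF solution_unique[OF flow_is_solution v this], of 0] show False
      using that by (simp add: v0 flow_initial)
  qed
  have mcont: "continuous_on UNIV (m y)" if "y \<noteq> x" for y
    unfolding m_def using ne[OF that]
    by (intro continuous_intros sol_cont[OF v] sol_cont[OF flow_is_solution]) auto
  have mbdd: "\<bar>m y t\<bar> \<le> \<bar>a\<bar> + \<bar>b - a\<bar>" if "y \<noteq> x" for y t
    using pwl_lipschitz[of a b "flow a b \<mu> t 0 y" "v t"] ne[OF that, of t]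
    by (simp add: m_def abs_divide pos_divide_le_eq)
  have quot: "(flow a b \<mu> T 0 y - v T) / (y - x) = exp (integral ({0..T} - C) (m y))"
    if y: "y \<noteq> x" for y
  proof -
    obtain M where M: "\<And>t. (M has_real_derivative m y t) (at t)" and M0: "M 0 = 0"
      using ex_antiderivative_with_value[OF mcont[OF y], of 0 0] by blast
    \<comment> \<open>The difference solves the linear equation \<open>w' = m w\<close>, so dividing
      it by the exponential of a primitive of \<open>m\<close> leaves a constant.\<close>
    define E where "E t = (flow a b \<mu> t 0 y - v t) * exp (- M t)" for t
    have "(E has_real_derivative 0) (at t)" for t
    proof -
      have "((\<lambda>t. flow a b \<mu> t 0 y - v t) has_real_derivative
          (m y t * (flow a b \<mu> t 0 y - v t))) (at t)"
      proof -
        have "((\<lambda>t. flow a b \<mu> t 0 y - v t) has_real_derivative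
            ((pwl a b (flow a b \<mu> t 0 y) + \<mu> * sin t) - (pwl a b (v t) + \<mu> * sin t))) (at t)"
          using v flow_is_solution[of a b \<mu> 0 y] unfolding is_solution_def by (intro DERIV_diff) auto
        then show ?thesis by (rule DERIV_cong) (use ne[OF y, of t] in \<open>simp add: m_def\<close>)
      qed
      from DERIV_mult[OF this DERIV_fun_exp[OF DERIV_minus[OF M]]] show ?thesis
        unfolding E_def by (rule DERIV_cong) simp
    qed
    then have "E T = E 0" using DERIV_isconst_all by blast
    then have "flow a b \<mu> T 0 y - v T = (y - x) * exp (M T)"
      by (simp add: E_def M0 v0 flow_initial exp_minus field_simps)
    moreover have "(m y has_integral (M T - M 0)) {0..T}"
      using T M by (intro fundamental_theorem_of_calculus)
        (auto simp: has_real_derivative_iff_has_vector_derivative has_vector_derivative_at_within)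
    then have "integral {0..T} (m y) = M T" by (simp add: M0 integral_unique)
    moreover have "integral ({0..T} - C) (m y) = integral {0..T} (m y)"
      by (rule integral_spike_set) (auto intro: negligible_subset[OF C])
    ultimately show ?thesis using y by simp
  qed
  \<comment> \<open>Dominated convergence concerns sequences, so the limit is tested along sequences
    that avoid \<open>x\<close>; the Lipschitz constant of the field dominates the slopes.\<close>
  have "((\<lambda>y. flow a b \<mu> T 0 y) has_real_derivative D) (at x)"
    unfolding has_field_derivative_iff tendsto_at_iff_sequentially
  proof (intro allI impI)
    fix X :: "nat \<Rightarrow> real" assume "\<forall>i. X i \<in> UNIV - {x}" and X: "X \<longlonglongrightarrow> x"
    then have Xne: "X n \<noteq> x" for n by auto
    have conv: "(\<lambda>n. m (X n) t) \<longlonglongrightarrow> g t" if t: "t \<in> {0..T} - C" for t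
    proof -
      have "(\<lambda>n. flow a b \<mu> t 0 (X n)) \<longlonglongrightarrow> v t"
      proof (rule LIM_zero_cancel, rule Lim_null_comparison)
        show "\<forall>\<^sub>F n in sequentially. norm (flow a b \<mu> t 0 (X n) - v t) \<le>
            \<bar>X n - x\<bar> * exp ((\<bar>a\<bar> + \<bar>b - a\<bar>) * \<bar>t - 0\<bar>)"
          using solutions_diff_growth[OF flow_is_solution v, of t 0 _ 0]
          by (simp add: v0 flow_initial)
        have "(\<lambda>n. \<bar>X n - x\<bar>) \<longlonglongrightarrow> 0" using X by (simp add: LIM_zero tendsto_rabs_zero)
        then show "(\<lambda>n. \<bar>X n - x\<bar> * exp ((\<bar>a\<bar> + \<bar>b - a\<bar>) * \<bar>t - 0\<bar>)) \<longlonglongrightarrow> 0"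
          by (rule tendsto_mult_left_zero)
      qed
      moreover have "\<bar>v t\<bar> \<noteq> 1" using t by (auto simp: C_def abs_if split: if_splits)
      ultimately have "\<forall>\<^sub>F n in sequentially. m (X n) t = g t"
        unfolding m_def g_def by (rule pwl_secant_slope_eventually) (rule ne[OF Xne])
      then show ?thesis by (rule tendsto_eventually)
    qed
    have spike: "f integrable_on ({0..T} - C)" if "f integrable_on {0..T}" for f :: "real \<Rightarrow> real"
      by (rule integrable_spike_set[OF that]) (auto intro: negligible_subset[OF C])
    have "(\<lambda>n. integral ({0..T} - C) (m (X n))) \<longlonglongrightarrow> integral ({0..T} - C) g"
    proof (rule dominated_convergence(2))
      show "m (X n) integrable_on ({0..T} - C)" for n
        using mcont[OF Xne] by (intro spike integrable_continuous_real) (rule continuous_on_subset, auto)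
      show "(\<lambda>_. \<bar>a\<bar> + \<bar>b - a\<bar>) integrable_on ({0..T} - C)"
        by (intro spike) (rule integrable_const_ivl)
      show "norm (m (X n) t) \<le> \<bar>a\<bar> + \<bar>b - a\<bar>" for n t using mbdd[OF Xne] by simp
    qed (rule conv)
    then have "(\<lambda>n. exp (integral ({0..T} - C) (m (X n)))) \<longlonglongrightarrow> D"
      unfolding D_def by (rule tendsto_exp)
    then show "((\<lambda>y. (flow a b \<mu> T 0 y - flow a b \<mu> T 0 x) / (y - x)) \<circ> X) \<longlonglongrightarrow> D"
      using quot[OF Xne] by (simp add: o_def v_def)
  qed
  then show ?thesis unfolding field_differentiable_def by blast
qed

section \<open>Symmetric and periodic solutions, and their transfer under time reversal\<close>

lemma exp_decay_at_top:
  fixes c :: real assumes "c < 0" shows "((\<lambda>t. exp (c * (t - s))) \<longlongrightarrow> 0) at_top"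
proof (rule filterlim_compose[OF exp_at_bot])
  have "filterlim (\<lambda>t. - s + t) at_top at_top"
    by (rule filterlim_tendsto_add_at_top[OF tendsto_const filterlim_ident])
  then show "filterlim (\<lambda>t. c * (t - s)) at_bot at_top"
    using filterlim_tendsto_neg_mult_at_bot[OF tendsto_const assms] by simp
qed

text \<open>By uniqueness, agreement with the negated half shift at one time \<open>s\<close>
  suffices. The reversed equation supplies it at \<open>s = - pi\<close>.\<close>

lemma solution_antiperiodic:
  assumes v: "is_solution a b \<mu> v" and s: "v (s + pi) = - v s"
  shows "v (t + pi) = - v t"
proof -
  have "(\<lambda>t. - v (t + pi)) = v"
    by (rule solution_unique[OF is_solution_half_shift[OF v] v, of s]) (use s in simp)
  from fun_cong[OF this, of t] show ?thesis by simp
qed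

lemma solution_periodic:
  assumes v: "is_solution a b \<mu> v" and s: "v (s + 2 * pi) = v s"
  shows "v (t + 2 * pi) = v t"
  using fun_cong[OF solution_unique[where s = s, OF is_solution_shift[OF v] v s]] .

lemma displacement_zero_imp_periodic:
  assumes "displacement a b \<mu> x = 0"
  shows "flow a b \<mu> (t + 2 * pi) 0 x = flow a b \<mu> t 0 x"
  by (rule solution_periodic[OF flow_is_solution, where s = 0])
    (use assms in \<open>simp add: displacement_def poincare_def flow_initial\<close>)

lemma symmetric_imp_displacement_zero:
  assumes "symmetric_at a b \<mu> x" shows "displacement a b \<mu> x = 0"
proof -
  have anti: "flow a b \<mu> (t + pi) 0 x = - flow a b \<mu> t 0 x" for t
    by (rule solution_antiperiodic[OF flow_is_solution, where s = 0])
      (use assms in \<open>simp add: symmetric_at_def flow_initial\<close>)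
  show ?thesis using anti[of pi] anti[of 0]
    by (simp add: displacement_def poincare_def flow_initial)
qed

lemma symmetric_at_reverse:
  assumes "symmetric_at (-a) (-b) \<mu> x" shows "symmetric_at a b \<mu> x"
proof -
  let ?v = "\<lambda>t. flow a b \<mu> t 0 x"
  have "?v (t + pi) = - ?v t" for t
    by (rule solution_antiperiodic[OF flow_is_solution, where s = "-pi"])
      (use assms in \<open>simp add: symmetric_at_def flow_reverse flow_initial\<close>)
  from this[of 0] show ?thesis by (simp add: symmetric_at_def flow_initial)
qed

lemma displacement_zero_reverse:
  "displacement (-a) (-b) \<mu> x = 0 \<longleftrightarrow> displacement a b \<mu> x = 0"
proof
  let ?v = "\<lambda>t. flow a b \<mu> t 0 x"
  show "displacement a b \<mu> x = 0" if "displacement (-a) (-b) \<mu> x = 0"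
  proof -
    have "?v (t + 2 * pi) = ?v t" for t
      by (rule solution_periodic[OF flow_is_solution, where s = "- 2 * pi"])
        (use that in \<open>simp add: displacement_def poincare_def flow_reverse flow_initial\<close>)
    from this[of 0] show ?thesis by (simp add: displacement_def poincare_def flow_initial)
  qed
  show "displacement (-a) (-b) \<mu> x = 0" if "displacement a b \<mu> x = 0"
    using displacement_zero_imp_periodic[OF that, of "- 2 * pi"]
    by (simp add: displacement_def poincare_def flow_reverse flow_initial)
qed

text \<open>The reversed map runs the flow from time 0 back to \<open>- 2 * pi\<close>, which by
  periodicity in time undoes the forward map.\<close>

lemma poincare_reverse_poincare: "poincare (-a) (-b) \<mu> (poincare a b \<mu> x) = x"
proof -
  have "flow a b \<mu> (- 2 * pi) 0 (flow a b \<mu> (2 * pi) 0 x) = flow a b \<mu> (- 2 * pi + 2 * pi) 0 x"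
    by (rule flow_eq[OF is_solution_shift[OF flow_is_solution]]) simp
  then show ?thesis by (simp add: poincare_def flow_reverse flow_initial)
qed

lemma poincare_differentiable:
  "\<mu> \<noteq> 0 \<Longrightarrow> poincare a b \<mu> field_differentiable (at x)"
  unfolding poincare_def [abs_def] by (rule flow_differentiable_in_initial_value) auto

text \<open>The Poincare maps of the two equations are inverse to each other, so the chain rule
  makes their derivatives at a fixed point reciprocal.\<close>

lemma hyperbolic_at_reverse:
  assumes mu: "\<mu> \<noteq> 0" and fp: "displacement a b \<mu> x = 0" and hyp: "hyperbolic_at (-a) (-b) \<mu> x"
  shows "hyperbolic_at a b \<mu> x"
proof -
  let ?P = "poincare a b \<mu>" and ?P' = "poincare (-a) (-b) \<mu>"
  have Px: "?P x = x" using fp by (simp add: displacement_def)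
  have P: "(?P has_real_derivative deriv ?P x) (at x)"
    using poincare_differentiable[OF mu] by (simp add: field_differentiable_derivI)
  have "(?P' has_real_derivative deriv ?P' x) (at (?P x))"
    using poincare_differentiable[OF mu] by (simp add: field_differentiable_derivI Px)
  from DERIV_chain2[OF this P] have "((\<lambda>x. x) has_real_derivative deriv ?P' x * deriv ?P x) (at x)"
    by (simp add: poincare_reverse_poincare)
  then have "deriv ?P' x * deriv ?P x = 1" using DERIV_ident DERIV_unique by blast
  then show ?thesis using hyp poincare_differentiable[OF mu] by (auto simp: hyperbolic_at_def)
qed

text \<open>Periodic solutions correspond to zeros of the displacement, and the point of a singleton
  zero set is isolated.\<close>

lemma unique_limit_cycle:
  assumes "{y. displacement a b \<mu> y = 0} = {x}"
  shows "limit_cycle a b \<mu> (\<lambda>t. flow a b \<mu> t 0 x)"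
    and "limit_cycle a b \<mu> v \<Longrightarrow> v = (\<lambda>t. flow a b \<mu> t 0 x)"
proof -
  have "displacement a b \<mu> x = 0" using assms by auto
  then show "limit_cycle a b \<mu> (\<lambda>t. flow a b \<mu> t 0 x)"
    unfolding limit_cycle_def assms
    by (auto simp: periodic_iff_displacement_zero[OF flow_is_solution] flow_initial isolated_in_def)
  assume "limit_cycle a b \<mu> v"
  then have v: "is_solution a b \<mu> v" and per: "periodic_solution a b \<mu> v"
    by (auto simp: limit_cycle_def periodic_solution_def)
  then have "v 0 \<in> {x}" unfolding assms[symmetric] by (simp add: periodic_iff_displacement_zero)
  then show "v = (\<lambda>t. flow a b \<mu> t 0 x)"
    by (intro solution_unique[OF v flow_is_solution, of 0]) (simp add: flow_initial)
qed

section \<open>Existence, uniqueness and stability of the periodic solution\<close>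

text \<open>Since the linear response changes sign after time \<open>pi\<close>, the map
  \<open>y \<mapsto> - flow a b \<mu> pi 0 y\<close> preserves the slice of the invariant tube at
  time 0. The intermediate value theorem gives a fixed point.\<close>

lemma symmetric_solution_exists:
  assumes a: "a < 0" and ab: "a \<le> b"
  obtains x where "symmetric_at a b \<mu> x" "\<bar>x - \<mu> * linear_response a 0\<bar> \<le> (b - a) / \<bar>a\<bar>"
proof -
  define r where "r = (b - a) / \<bar>a\<bar>"
  define c where "c = \<mu> * linear_response a 0"
  have r: "r \<ge> 0" using ab by (simp add: r_def)
  have map: "\<bar>- flow a b \<mu> pi 0 y - c\<bar> \<le> r" if "\<bar>y - c\<bar> \<le> r" for y
  proof -
    have "\<bar>flow a b \<mu> pi 0 y - \<mu> * linear_response a pi\<bar> \<le> r"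
      by (rule linear_response_tube_invariant[OF a ab flow_is_solution, of 0])
        (use that in \<open>auto simp: r_def c_def flow_initial\<close>)
    then show ?thesis by (simp add: linear_response_pi c_def abs_le_iff)
  qed
  have "(exp ((\<bar>a\<bar> + \<bar>b - a\<bar>) * pi))-lipschitz_on {c - r..c + r} (\<lambda>y. flow a b \<mu> pi 0 y)"
  proof (rule lipschitz_onI)
    fix y z
    show "dist (flow a b \<mu> pi 0 y) (flow a b \<mu> pi 0 z) \<le> exp ((\<bar>a\<bar> + \<bar>b - a\<bar>) * pi) * dist y z"
      using solutions_diff_growth[OF flow_is_solution[of a b \<mu> 0 y] flow_is_solution[of a b \<mu> 0 z], of pi 0]
      by (simp add: dist_real_def flow_initial mult.commute)
  qed simp
  then have "continuous_on {c - r..c + r} (\<lambda>y. - flow a b \<mu> pi 0 y - y)"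
    by (intro continuous_intros lipschitz_on_continuous_on)
  moreover have "- flow a b \<mu> pi 0 (c + r) - (c + r) \<le> 0" "0 \<le> - flow a b \<mu> pi 0 (c - r) - (c - r)"
    using map[of "c + r"] map[of "c - r"] r by auto
  ultimately obtain x where "c - r \<le> x" "x \<le> c + r" "- flow a b \<mu> pi 0 x - x = 0"
    using IVT2'[of "\<lambda>y. - flow a b \<mu> pi 0 y - y" "c + r" 0 "c - r"] r by auto
  then show thesis by (intro that[of x]) (auto simp: symmetric_at_def r_def c_def)
qed

text \<open>Over one period the distance \<open>z\<close> returns to itself, so it is at most a
  convex combination of itself and the radius, with positive weight on the radius.\<close>

lemma periodic_solution_in_tube:
  assumes a: "a < 0" and ab: "a \<le> b" and x: "displacement a b \<mu> x = 0"
  shows "\<bar>flow a b \<mu> t 0 x - \<mu> * linear_response a t\<bar> \<le> (b - a) / \<bar>a\<bar>"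
proof -
  define z where "z = \<bar>flow a b \<mu> t 0 x - \<mu> * linear_response a t\<bar>"
  define e where "e = exp (a * (2 * pi))"
  have e: "e < 1" using a by (simp add: e_def mult_neg_pos)
  have "z \<le> z * e + (b - a) / \<bar>a\<bar> * (1 - e)"
    using distance_to_linear_response[OF a ab flow_is_solution[of a b \<mu> 0 x], of t "t + 2 * pi"]
    by (simp only: displacement_zero_imp_periodic[OF x] linear_response_periodic)
      (simp add: z_def e_def)
  then have "z * (1 - e) \<le> (b - a) / \<bar>a\<bar> * (1 - e)" by (simp add: algebra_simps)
  then show ?thesis unfolding z_def by (rule mult_right_le_imp_le) (use e in simp)
qed

lemma displacement_zero_unique:
  assumes a: "a < 0" and b: "b > 0" and mu: "\<bar>\<mu>\<bar> > forcing_threshold a b"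
    and x: "displacement a b \<mu> x = 0" and y: "displacement a b \<mu> y = 0"
  shows "x = y"
proof -
  have ab: "a \<le> b" using a b by simp
  note tube = periodic_solution_in_tube[OF a ab x, of 0] periodic_solution_in_tube[OF a ab y, of 0]
  have per: "flow a b \<mu> (2 * pi) 0 x = x" "flow a b \<mu> (2 * pi) 0 y = y"
    using x y by (auto simp: displacement_def poincare_def)
  \<comment> \<open>Contraction over one period, with exponent \<open>a (2 pi - pi)\<close>.\<close>
  have "(x - y)\<^sup>2 \<le> (x - y)\<^sup>2 * exp (a * pi)"
    using solutions_in_tube_contract[OF a b mu flow_is_solution[of a b \<mu> 0 x]
        flow_is_solution[of a b \<mu> 0 y], of 0 "2 * pi"] tube
    by (simp add: per flow_initial)
  moreover have "exp (a * pi) < 1" using a by (simp add: mult_neg_pos)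
  ultimately have "\<not> (x - y)\<^sup>2 > 0" by (simp add: mult_le_cancel_left1)
  then show ?thesis by simp
qed

text \<open>Contraction over one period bounds the squared difference quotients of the Poincare map
  by \<open>exp (a pi)\<close>, which is less than 1, and the bound passes to the
  derivative.\<close>

lemma periodic_solution_hyperbolic:
  assumes a: "a < 0" and b: "b > 0" and mu: "\<bar>\<mu>\<bar> > forcing_threshold a b" "\<mu> \<noteq> 0"
    and x: "displacement a b \<mu> x = 0"
  shows "hyperbolic_at a b \<mu> x"
proof -
  let ?P = "poincare a b \<mu>"
  have ab: "a \<le> b" using a b by simp
  note tube = periodic_solution_in_tube[OF a ab x, of 0]
  have "(?P has_real_derivative deriv ?P x) (at x)"
    using poincare_differentiable[OF mu(2)] by (simp add: field_differentiable_derivI)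
  then have "((\<lambda>y. ((?P y - ?P x) / (y - x))\<^sup>2) \<longlongrightarrow> (deriv ?P x)\<^sup>2) (at x)"
    unfolding has_field_derivative_iff by (rule tendsto_power)
  moreover have "\<forall>\<^sub>F y in at x. ((?P y - ?P x) / (y - x))\<^sup>2 \<le> exp (a * pi)"
    unfolding eventually_at
  \<comment> \<open>Within distance 1 of \<open>x\<close> the initial value lies in the slightly
    larger tube in which solutions contract.\<close>
  proof (intro exI[of _ 1] conjI ballI impI)
    fix y assume "y \<noteq> x \<and> dist y x < 1"
    then have y: "(y - x)\<^sup>2 > 0" "\<bar>y - x\<bar> < 1" by (auto simp: dist_real_def)
    have "(?P y - ?P x)\<^sup>2 \<le> (y - x)\<^sup>2 * exp (a * pi)"
      using solutions_in_tube_contract[OF a b mu(1) flow_is_solution[of a b \<mu> 0 y]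
          flow_is_solution[of a b \<mu> 0 x], of 0 "2 * pi"] tube y(2)
      by (simp add: flow_initial poincare_def)
    then show "((?P y - ?P x) / (y - x))\<^sup>2 \<le> exp (a * pi)"
      using y(1) by (simp add: power_divide pos_divide_le_eq mult.commute)
  qed simp
  ultimately have "(deriv ?P x)\<^sup>2 \<le> exp (a * pi)" by (rule tendsto_upperbound) simp
  also have "\<dots> < 1" using a by (simp add: mult_neg_pos)
  finally have "deriv ?P x \<noteq> 1" by auto
  then show ?thesis using poincare_differentiable[OF mu(2)] by (simp add: hyperbolic_at_def)
qed

lemma periodic_solution_globally_asymptotically_stable:
  assumes a: "a < 0" and b: "b > 0" and mu: "\<bar>\<mu>\<bar> > forcing_threshold a b"
    and x: "displacement a b \<mu> x = 0"
  shows "globally_asymptotically_stable a b \<mu> (\<lambda>t. flow a b \<mu> t 0 x)"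
  unfolding globally_asymptotically_stable_def
proof (intro allI conjI)
  fix \<tau>
  define v where "v t = flow a b \<mu> t 0 x" for t
  have ab: "a \<le> b" using a b by simp
  have v: "is_solution a b \<mu> v" unfolding v_def by (rule flow_is_solution)
  have tube: "\<bar>v t - \<mu> * linear_response a t\<bar> \<le> (b - a) / \<bar>a\<bar>" for t
    unfolding v_def by (rule periodic_solution_in_tube[OF a ab x])
  show "stable_from a b \<mu> \<tau> (\<lambda>t. flow a b \<mu> t 0 x)"
    unfolding stable_from_def v_def[symmetric]
  proof (intro allI impI)
    fix \<epsilon> :: real assume \<epsilon>: "\<epsilon> > 0"
    define q where "q = exp (a * pi / 2)"
    have q: "q > 0" "q\<^sup>2 = exp (a * pi)" by (auto simp: q_def simp flip: exp_double)
    show "\<exists>\<delta>>0. \<forall>y. \<bar>y - v \<tau>\<bar> < \<delta> \<longrightarrow> (\<forall>t\<ge>\<tau>. \<bar>flow a b \<mu> t \<tau> y - v t\<bar> < \<epsilon>)"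
    \<comment> \<open>The bound 1 keeps the perturbed solution in the contracting tube. The factor
      \<open>q\<close> pays for the weight, since \<open>exp (a (t - \<tau> - pi))\<close> is at
      most \<open>1 / q^2\<close>.\<close>
    proof (intro exI[of _ "min 1 (\<epsilon> * q)"] conjI allI impI)
      show "min 1 (\<epsilon> * q) > 0" using \<epsilon> q by simp
      fix y t assume y: "\<bar>y - v \<tau>\<bar> < min 1 (\<epsilon> * q)" and t: "\<tau> \<le> t"
      have "(flow a b \<mu> t \<tau> y - v t)\<^sup>2 \<le> (y - v \<tau>)\<^sup>2 * exp (a * (t - \<tau> - pi))"
      proof -
        have "\<bar>y - \<mu> * linear_response a \<tau>\<bar> \<le> (b - a) / \<bar>a\<bar> + 1" using tube[of \<tau>] y by linarith
        then show ?thesis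
          using solutions_in_tube_contract[OF a b mu flow_is_solution[of a b \<mu> \<tau> y] v t] tube[of \<tau>]
          by (simp add: flow_initial)
      qed
      also have "\<dots> \<le> (y - v \<tau>)\<^sup>2 * exp (- (a * pi))"
        using a t by (intro mult_left_mono) (auto simp: algebra_simps mult_left_mono_neg)
      also have "\<dots> = (\<bar>y - v \<tau>\<bar> / q)\<^sup>2"
        by (simp add: power_divide q exp_minus field_simps)
      finally have "\<bar>flow a b \<mu> t \<tau> y - v t\<bar> \<le> \<bar>y - v \<tau>\<bar> / q"
        using q by (simp add: abs_le_square_iff[symmetric] abs_divide)
      also have "\<dots> < \<epsilon>" using y q by (simp add: pos_divide_less_eq)
      finally show "\<bar>flow a b \<mu> t \<tau> y - v t\<bar> < \<epsilon>" .
    qed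
  qed
  fix y
  define u where "u t = flow a b \<mu> t \<tau> y" for t
  have u: "is_solution a b \<mu> u" unfolding u_def by (rule flow_is_solution)
  \<comment> \<open>From the entry time \<open>s\<close> on, contraction applies; \<open>s\<close>
    may precede \<tau>, as solutions exist on the whole line.\<close>
  obtain s where s: "\<bar>u s - \<mu> * linear_response a s\<bar> \<le> (b - a) / \<bar>a\<bar> + 1"
    using linear_response_tube_attracting[OF a ab u, of 0] by blast
  have "((\<lambda>t. (u s - v s)\<^sup>2 * exp (a * (t - (s + pi)))) \<longlongrightarrow> 0) at_top"
    by (rule tendsto_mult_right_zero[OF exp_decay_at_top[OF a]])
  moreover have "\<forall>\<^sub>F t in at_top. norm ((u t - v t)\<^sup>2) \<le> (u s - v s)\<^sup>2 * exp (a * (t - (s + pi)))"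
    using eventually_ge_at_top[of s]
  proof eventually_elim
    case (elim t)
    then show ?case
      using solutions_in_tube_contract[OF a b mu u v elim s] tube[of s] by (simp add: diff_diff_eq)
  qed
  ultimately have "((\<lambda>t. (u t - v t)\<^sup>2) \<longlongrightarrow> 0) at_top" by (rule Lim_null_comparison[rotated])
  then have "((\<lambda>t. sqrt ((u t - v t)\<^sup>2)) \<longlongrightarrow> sqrt 0) at_top" by (rule tendsto_real_sqrt)
  then show "((\<lambda>t. flow a b \<mu> t \<tau> y - flow a b \<mu> t 0 x) \<longlongrightarrow> 0) at_top"
    unfolding u_def v_def by (simp add: tendsto_rabs_zero_iff)
qed

text \<open>In reversed time the contraction runs from \<open>t\<close> back to \<tau>. A solution
  staying within 1 of the periodic one for all later times would have its distance at \<tau> bounded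
  by arbitrarily small numbers.\<close>

lemma periodic_solution_unstable:
  assumes a: "a > 0" and b: "b < 0" and mu: "\<bar>\<mu>\<bar> > forcing_threshold (-a) (-b)"
    and x: "displacement a b \<mu> x = 0"
  shows "unstable a b \<mu> (\<lambda>t. flow a b \<mu> t 0 x)"
  unfolding unstable_def
proof (intro allI notI)
  fix \<tau>
  have a': "-a < 0" and b': "-b > 0" and ab: "-a \<le> -b" using a b by auto
  define v where "v t = flow a b \<mu> t 0 x" for t
  assume "stable_from a b \<mu> \<tau> (\<lambda>t. flow a b \<mu> t 0 x)"
  then obtain \<delta> where \<delta>: "\<delta> > 0" and
    close: "\<And>y t. \<bar>y - v \<tau>\<bar> < \<delta> \<Longrightarrow> \<tau> \<le> t \<Longrightarrow> \<bar>flow a b \<mu> t \<tau> y - v t\<bar> < 1"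
    unfolding stable_from_def v_def by (metis zero_less_one)
  define u where "u t = flow a b \<mu> t \<tau> (v \<tau> + \<delta> / 2)" for t
  have u: "is_solution (-a) (-b) \<mu> (\<lambda>t. u (- t))" and v: "is_solution (-a) (-b) \<mu> (\<lambda>t. v (- t))"
    unfolding u_def v_def by (rule is_solution_reverse[OF flow_is_solution])+
  have tube: "\<bar>v (- t) - \<mu> * linear_response (-a) t\<bar> \<le> (-b - -a) / \<bar>-a\<bar>" for t
    using periodic_solution_in_tube[OF a' ab, of \<mu> x t] x
    by (simp add: displacement_zero_reverse flow_reverse v_def)
  have "\<forall>\<^sub>F t in at_top. (\<delta> / 2)\<^sup>2 \<le> exp ((-a) * (t - (\<tau> + pi)))"
    using eventually_ge_at_top[of \<tau>]
  proof eventually_elim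
    case (elim t)
    have c: "\<bar>u t - v t\<bar> < 1" unfolding u_def by (rule close) (use \<delta> elim in auto)
    have "(u \<tau> - v \<tau>)\<^sup>2 \<le> (u t - v t)\<^sup>2 * exp ((-a) * (t - (\<tau> + pi)))"
      using solutions_in_tube_contract[OF a' b' mu u v, of "-t" "-\<tau>"] tube[of "-t"] c elim
      by (simp add: algebra_simps)
    also have "\<dots> \<le> 1 * exp ((-a) * (t - (\<tau> + pi)))"
      using c by (intro mult_right_mono) (auto simp: abs_square_le_1)
    finally show ?case by (simp add: u_def flow_initial)
  qed
  then have "(\<delta> / 2)\<^sup>2 \<le> 0" by (rule tendsto_lowerbound[OF exp_decay_at_top[OF a']]) simp
  then show False using \<delta> by simp
qed

section \<open>The bound on the initial condition and the two sign cases\<close>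

text \<open>The second bound lets the tube radius \<open>(b - a) / |a|\<close> be replaced by
  \<open>|\<mu>| / |a|\<close> in the estimate of the initial condition.\<close>

lemma forcing_threshold_ge:
  assumes a: "a < 0" and b: "b > 0"
  shows "forcing_threshold a b > 0" "b - a \<le> forcing_threshold a b"
proof -
  define r where "r = (b - a) / \<bar>a\<bar>"
  have r: "r > 0" and ra: "b - a = r * \<bar>a\<bar>" using a b by (auto simp: r_def divide_pos_neg)
  have F: "forcing_threshold a b = (4 * r + 1) * (r + 2) * (1 + a\<^sup>2)"
    by (simp add: forcing_threshold_def r_def)
  show "forcing_threshold a b > 0" unfolding F using r one_plus_square_pos[of a] by simp
  have "\<bar>a\<bar> \<le> 1 + a\<^sup>2" using zero_le_power2[of "\<bar>a\<bar> - 1"]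
    by (simp add: power2_diff)
  moreover have "r \<le> (4 * r + 1) * (r + 2)" using r by (simp add: algebra_simps)
  ultimately show "b - a \<le> forcing_threshold a b"
    unfolding F ra using r by (intro mult_mono) auto
qed

lemma attracting_case:
  assumes a: "a < 0" and b: "b > 0" and mu: "\<bar>\<mu>\<bar> > forcing_threshold a b"
  obtains x where "symmetric_at a b \<mu> x" "{y. displacement a b \<mu> y = 0} = {x}"
    "\<bar>x\<bar> \<le> \<bar>\<mu>\<bar> * (1 + 1 / \<bar>a\<bar>)"
proof -
  obtain x where x: "symmetric_at a b \<mu> x" and tube: "\<bar>x - \<mu> * linear_response a 0\<bar> \<le> (b - a) / \<bar>a\<bar>"
    using symmetric_solution_exists[of a b] a b by auto
  note d = symmetric_imp_displacement_zero[OF x]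
  \<comment> \<open>The value is \<open>- 1 / (1 + a^2)\<close>. The centre of the tube contributes
    \<open>|\<mu>|\<close> to the bound and its radius contributes
    \<open>|\<mu>| / |a|\<close>.\<close>
  have "\<bar>linear_response a 0\<bar> \<le> 1"
    using one_plus_square_pos[of a] by (simp add: linear_response_def abs_divide)
  then have "\<bar>\<mu> * linear_response a 0\<bar> \<le> \<bar>\<mu>\<bar>" by (simp add: abs_mult mult_left_le)
  moreover have "(b - a) / \<bar>a\<bar> \<le> \<bar>\<mu>\<bar> / \<bar>a\<bar>"
    using forcing_threshold_ge(2)[OF a b] mu by (intro divide_right_mono) auto
  ultimately have "\<bar>x\<bar> \<le> \<bar>\<mu>\<bar> + \<bar>\<mu>\<bar> / \<bar>a\<bar>" using tube by linarith
  then have "\<bar>x\<bar> \<le> \<bar>\<mu>\<bar> * (1 + 1 / \<bar>a\<bar>)" by (simp add: algebra_simps)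
  moreover have "{y. displacement a b \<mu> y = 0} = {x}"
    using d by (auto dest: displacement_zero_unique[OF a b mu d])
  ultimately show thesis using that x by blast
qed

theorem theorem5p5:
  fixes a b :: real
  assumes "a * b < 0"
  shows "\<exists>\<mu>0>0. \<forall>\<mu>. \<bar>\<mu>\<bar> > \<mu>0 \<longrightarrow>
    (\<exists>x. limit_cycle a b \<mu> (\<lambda>t. flow a b \<mu> t 0 x) \<and>
         (\<forall>v. limit_cycle a b \<mu> v \<longrightarrow> v = (\<lambda>t. flow a b \<mu> t 0 x)) \<and>
         symmetric_at a b \<mu> x \<and>
         hyperbolic_at a b \<mu> x \<and>
         (b > 0 \<longrightarrow> globally_asymptotically_stable a b \<mu> (\<lambda>t. flow a b \<mu> t 0 x)) \<and>
         (b < 0 \<longrightarrow> unstable a b \<mu> (\<lambda>t. flow a b \<mu> t 0 x)) \<and>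
         \<bar>x\<bar> \<le> \<bar>\<mu>\<bar> * (1 + 1 / \<bar>a\<bar>))"
    (is "\<exists>\<mu>0>0. \<forall>\<mu>. _ \<longrightarrow> ?P \<mu>")
proof (cases "a < 0")
  case True
  then have b: "b > 0" using assms by (simp add: mult_less_0_iff)
  note pos = forcing_threshold_ge(1)[OF True b]
  show ?thesis
  proof (rule exI[of _ "forcing_threshold a b"], intro conjI allI impI pos)
    fix \<mu> assume mu: "\<bar>\<mu>\<bar> > forcing_threshold a b"
    then have "\<mu> \<noteq> 0" using pos by auto
    obtain x where sym: "symmetric_at a b \<mu> x"
      and set: "{y. displacement a b \<mu> y = 0} = {x}"
      and bound: "\<bar>x\<bar> \<le> \<bar>\<mu>\<bar> * (1 + 1 / \<bar>a\<bar>)"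
      using attracting_case[OF True b mu] by blast
    have d: "displacement a b \<mu> x = 0" using set by auto
    show "?P \<mu>"
      by (intro exI[of _ x] conjI allI impI unique_limit_cycle[OF set] sym bound
          periodic_solution_hyperbolic[OF True b mu \<open>\<mu> \<noteq> 0\<close> d]
          periodic_solution_globally_asymptotically_stable[OF True b mu d])
        (use b in auto)
  qed
next
  case False
  then have a: "a > 0" and b: "b < 0" using assms by (auto simp: mult_less_0_iff)
  \<comment> \<open>The reversed equation falls under the attracting case; its zero set, symmetry
    and hyperbolicity carry back, while contraction in reversed time becomes instability.\<close>
  then have a': "-a < 0" and b': "-b > 0" by auto
  note pos = forcing_threshold_ge(1)[OF a' b']
  show ?thesis
  proof (rule exI[of _ "forcing_threshold (-a) (-b)"], intro conjI allI impI pos)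
    fix \<mu> assume mu: "\<bar>\<mu>\<bar> > forcing_threshold (-a) (-b)"
    then have "\<mu> \<noteq> 0" using pos by auto
    obtain x where sym: "symmetric_at (-a) (-b) \<mu> x"
      and set': "{y. displacement (-a) (-b) \<mu> y = 0} = {x}"
      and bound: "\<bar>x\<bar> \<le> \<bar>\<mu>\<bar> * (1 + 1 / \<bar>-a\<bar>)"
      using attracting_case[OF a' b' mu] by blast
    have set: "{y. displacement a b \<mu> y = 0} = {x}"
      using set' by (simp add: displacement_zero_reverse)
    then have d: "displacement a b \<mu> x = 0" by auto
    then have d': "displacement (-a) (-b) \<mu> x = 0" by (simp add: displacement_zero_reverse)
    show "?P \<mu>"
      by (intro exI[of _ x] conjI allI impI unique_limit_cycle[OF set] symmetric_at_reverse[OF sym]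
          bound[unfolded abs_minus_cancel] periodic_solution_unstable[OF a b mu d]
          hyperbolic_at_reverse[OF \<open>\<mu> \<noteq> 0\<close> d]
          periodic_solution_hyperbolic[OF a' b' mu \<open>\<mu> \<noteq> 0\<close> d'])
        (use b in auto)
  qed
qed

end
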